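(* For every integer $n\ge 0$, with $G_n,H_n,A_n,B_n,C_n$ the $(n+1)\times(n+1)$ matrices defined in the context, one has $$H_n=G_nC_n^{*},\qquad H_n^{-1}=B_n^{*}A_n,$$ and $$\det G_n=\prod_{j=0}^{n}a_{j,j}^{-2},\qquad \det C_n=\prod_{j=0}^{n}c_{j,j},\qquad \det H_n=\prod_{j=0}^{n}\frac{\overline{c_{j,j}}}{a_{j,j}^{2}},$$ where $M^{*}$ denotes the Hermitian conjugate (conjugate transpose) of a matrix $M$.
   Context: $E$ is a complex inner product space whose inner product $(\cdot,\cdot)$ is linear in the first and conjugate-linear in the second argument, and $\{u_n\}_{n=0}^\infty$ is a sequence of linearly independent vectors in $E$. Put $G_n=(m_{j,k})_{j,k=0}^n$ with $m_{j,k}=(u_j,u_k)$. Let $\{p_n\}_{n=0}^\infty$ be the unique orthonormal system obtained from $\{u_n\}$ by Gram--Schmidt, $p_n=\sum_{j=0}^n a_{n,j}u_j$ with $a_{n,n}>0$. Let $\{v_n\}_{n=0}^\infty\subset E$ be given by $v_n=\sum_{j=0}^n c_{n,j}u_j$ with $c_{n,n}\ne 0$ for all $n\ge 0$ (complex coefficients). Then the $v_n$ are also linearly independent, and one writes $p_n=\sum_{k=0}^n b_{n,k}v_k$. Put $H_n=(I_{j,k})_{j,k=0}^n$ with $I_{j,k}=(u_j,v_k)$, $A_n=(a_{j,k})_{j,k=0}^n$, $B_n=(b_{j,k})_{j,k=0}^n$, $C_n=(c_{j,k})_{j,k=0}^n$, with the convention $a_{j,k}=b_{j,k}=c_{j,k}=0$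 for $k>j$. *)

theory Defs
  imports "Jordan_Normal_Form.Schur_Decomposition"
begin

(* Linear in the first argument; conjugate-linearity in the second follows from ip_commute.
   In the order on complex numbers, 0 < z means that z is real and positive. *)
locale complex_inner_product_space = vector_space scale
  for scale :: "complex \<Rightarrow> 'e::ab_group_add \<Rightarrow> 'e" +
  fixes ip :: "'e \<Rightarrow> 'e \<Rightarrow> complex"
  assumes ip_add_left: "ip (x + y) z = ip x z + ip y z"
    and ip_scale_left: "ip (scale r x) y = r * ip x y"
    and ip_commute: "ip y x = cnj (ip x y)"
    and ip_pos: "x \<noteq> 0 \<Longrightarrow> 0 < ip x x"
begin

fun gram_schmidt_seq :: "(nat \<Rightarrow> 'e) \<Rightarrow> nat \<Rightarrow> 'e" where
  "gram_schmidt_seq u n =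
     (let w = u n - (\<Sum>k<n. scale (ip (u n) (gram_schmidt_seq u k)) (gram_schmidt_seq u k))
      in scale (1 / complex_of_real (sqrt (Re (ip w w)))) w)"

declare gram_schmidt_seq.simps [simp del]

definition orthonormal_seq :: "(nat \<Rightarrow> 'e) \<Rightarrow> bool" where
  "orthonormal_seq p \<longleftrightarrow> (\<forall>i j. ip (p i) (p j) = (if i = j then 1 else 0))"

lemma ip_add_right: "ip x (y + z) = ip x y + ip x z"
  by (metis ip_commute ip_add_left complex_cnj_add)

lemma ip_scale_right: "ip x (scale r y) = cnj r * ip x y"
  by (metis ip_commute ip_scale_left complex_cnj_mult)

lemma ip_zero_left [simp]: "ip 0 x = 0"
  using ip_add_left[of 0 0 x] by simp

lemma ip_zero_right [simp]: "ip x 0 = 0"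
  using ip_add_right[of x 0 0] by simp

lemma ip_diff_left: "ip (x - y) z = ip x z - ip y z"
  using ip_add_left[of "x - y" y z] by simp

lemma ip_sum_left: "ip (\<Sum>i\<in>A. f i) x = (\<Sum>i\<in>A. ip (f i) x)"
  by (induction A rule: infinite_finite_induct) (auto simp: ip_add_left)

lemma ip_eq_zeroD: "ip x x = 0 \<Longrightarrow> x = 0"
  using ip_pos[of x] by auto

lemma ip_orthogonal_span:
  assumes "\<And>y. y \<in> S \<Longrightarrow> ip x y = 0" "z \<in> span S"
  shows "ip x z = 0"
  using assms(2)
  by (induction rule: span_induct_alt) (auto simp: ip_add_right ip_scale_right assms(1))

lemma span_image_lessThan:
  fixes u :: "nat \<Rightarrow> 'e"
  assumes "x \<in> span (u ` {..<n})"
  shows "\<exists>r. x = (\<Sum>j<n. scale (r j) (u j))"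
  using assms
proof (induction n arbitrary: x)
  case (Suc n)
  have "u ` {..<Suc n} = insert (u n) (u ` {..<n})"
    by (auto simp: lessThan_Suc)
  then obtain k where "x - scale k (u n) \<in> span (u ` {..<n})"
    using Suc.prems by (metis span_breakdown_eq)
  then obtain r where r: "x - scale k (u n) = (\<Sum>j<n. scale (r j) (u j))"
    using Suc.IH by blast
  have "x = (\<Sum>j<n. scale (r j) (u j)) + scale k (u n)"
    using r by (metis diff_add_cancel)
  then have "x = (\<Sum>j<Suc n. scale ((r(n := k)) j) (u j))"
    by simp
  then show ?case by blast
qed auto

lemma gram_schmidt_seq_in_span: "gram_schmidt_seq u n \<in> span (u ` {..n})"
proof (induction n rule: less_induct)
  case (less n)
  have "gram_schmidt_seq u k \<in> span (u ` {..n})" if "k < n" for k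
    using less[OF that] that by (meson atMost_subset_iff image_mono less_imp_le span_mono subsetD)
  then show ?case
    unfolding gram_schmidt_seq.simps[of u n] Let_def
    by (intro span_scale span_diff span_sum) (auto intro: span_base)
qed

context
  fixes u :: "nat \<Rightarrow> 'e"
  assumes inj: "inj u" and indep: "independent (range u)"
begin

lemma not_in_span_previous: "u n \<notin> span (u ` {..<n})"
proof
  assume *: "u n \<in> span (u ` {..<n})"
  have "u ` {..<n} \<subseteq> range u - {u n}"
    using inj by (auto dest: injD)
  with * have "u n \<in> span (range u - {u n})"
    using span_mono by blast
  with indep show False
    unfolding dependent_def by blast
qed

lemma gram_schmidt_seq_step:
  obtains c y where "0 < c" "y \<in> span (u ` {..<n})"
    "gram_schmidt_seq u n = scale c (u n - y)"
    "y = (\<Sum>k<n. scale (ip (u n) (gram_schmidt_seq u k)) (gram_schmidt_seq u k))"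
    "ip (gram_schmidt_seq u n) (gram_schmidt_seq u n) = 1"
proof -
  define y where "y = (\<Sum>k<n. scale (ip (u n) (gram_schmidt_seq u k)) (gram_schmidt_seq u k))"
  define w where "w = u n - y"
  define s where "s = sqrt (Re (ip w w))"
  have "gram_schmidt_seq u k \<in> span (u ` {..<n})" if "k < n" for k
    using gram_schmidt_seq_in_span[of u k] that
    by (meson atMost_iff image_mono le_less_trans lessThan_iff span_mono subsetD subsetI)
  then have y: "y \<in> span (u ` {..<n})"
    unfolding y_def by (intro span_sum span_scale) auto
  then have "w \<noteq> 0"
    using not_in_span_previous[of n] by (auto simp: w_def)
  then have "0 < ip w w"
    by (rule ip_pos)
  then have w: "0 < Re (ip w w)" "Im (ip w w) = 0"
    by (auto simp: less_complex_def)
  then have s: "0 < s" "ip w w = complex_of_real (s * s)"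
    by (auto simp: s_def complex_eq_iff)
  have gs: "gram_schmidt_seq u n = scale (1 / complex_of_real s) w"
    unfolding gram_schmidt_seq.simps[of u n] Let_def s_def w_def y_def ..
  show ?thesis
  proof (rule that[of "1 / complex_of_real s" y])
    show "0 < 1 / complex_of_real s"
      using s(1) by (simp add: less_complex_def Re_divide Im_divide)
    show "ip (gram_schmidt_seq u n) (gram_schmidt_seq u n) = 1"
      using s by (simp add: gs ip_scale_left ip_scale_right)
  qed (use gs y in \<open>auto simp: w_def y_def\<close>)
qed

lemma gram_schmidt_seq_orthogonal:
  "m < n \<Longrightarrow> ip (gram_schmidt_seq u n) (gram_schmidt_seq u m) = 0"
proof (induction n arbitrary: m rule: less_induct)
  case (less n)
  obtain c y where gs: "gram_schmidt_seq u n = scale c (u n - y)"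
    and y: "y = (\<Sum>k<n. scale (ip (u n) (gram_schmidt_seq u k)) (gram_schmidt_seq u k))"
    by (rule gram_schmidt_seq_step)
  have orth: "ip (gram_schmidt_seq u k) (gram_schmidt_seq u m) = (if k = m then 1 else 0)"
    if "k < n" for k
  proof (cases k m rule: linorder_cases)
    case less
    then show ?thesis
      using less.IH[OF \<open>m < n\<close>, of k] ip_commute[of "gram_schmidt_seq u k" "gram_schmidt_seq u m"]
      by (metis complex_cnj_cancel_iff complex_cnj_zero less_irrefl)
  next
    case equal
    then show ?thesis
      by (metis gram_schmidt_seq_step)
  next
    case greater
    then show ?thesis using less.IH[OF that, of m] by simp
  qed
  have "ip y (gram_schmidt_seq u m)
      = (\<Sum>k<n. if k = m then ip (u n) (gram_schmidt_seq u k) else 0)"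
    unfolding y ip_sum_left ip_scale_left by (rule sum.cong) (auto simp: orth)
  also have "\<dots> = ip (u n) (gram_schmidt_seq u m)"
    using less.prems by simp
  finally show ?case
    by (simp add: gs ip_scale_left ip_diff_left)
qed

theorem gram_schmidt_seq_orthonormal: "orthonormal_seq (gram_schmidt_seq u)"
  unfolding orthonormal_seq_def
proof (intro allI)
  fix i j
  show "ip (gram_schmidt_seq u i) (gram_schmidt_seq u j) = (if i = j then 1 else 0)"
  proof (cases i j rule: linorder_cases)
    case less
    then show ?thesis
      using gram_schmidt_seq_orthogonal[OF less]
        ip_commute[of "gram_schmidt_seq u i" "gram_schmidt_seq u j"] by simp
  next
    case equal
    then show ?thesis by (metis gram_schmidt_seq_step)
  next
    case greater
    then show ?thesis using gram_schmidt_seq_orthogonal by simp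
  qed
qed

theorem gram_schmidt_seq_coefficients:
  "\<exists>a. (\<forall>n. gram_schmidt_seq u n = (\<Sum>j\<le>n. scale (a n j) (u j)))
     \<and> (\<forall>n. 0 < a n n) \<and> (\<forall>j k. j < k \<longrightarrow> a j k = 0)"
proof -
  have "\<exists>r. gram_schmidt_seq u n = (\<Sum>j\<le>n. scale (r j) (u j)) \<and> 0 < r n \<and> (\<forall>k>n. r k = 0)" for n
  proof -
    obtain c y where c: "0 < c" "y \<in> span (u ` {..<n})" "gram_schmidt_seq u n = scale c (u n - y)"
      by (rule gram_schmidt_seq_step)
    obtain r where r: "y = (\<Sum>j<n. scale (r j) (u j))"
      using span_image_lessThan[OF c(2)] by blast
    let ?r = "\<lambda>j. if j = n then c else if j < n then - (c * r j) else 0"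
    have "(\<Sum>j\<le>n. scale (?r j) (u j)) = (\<Sum>j<n. scale (?r j) (u j)) + scale c (u n)"
      by (simp add: lessThan_Suc_atMost[symmetric])
    also have "(\<Sum>j<n. scale (?r j) (u j)) = - scale c y"
      unfolding r scale_sum_right sum_negf[symmetric]
      by (rule sum.cong) (auto simp: scale_minus_left)
    finally have "gram_schmidt_seq u n = (\<Sum>j\<le>n. scale (?r j) (u j))"
      by (simp add: c(3) scale_right_diff_distrib)
    then show ?thesis
      using c(1) by (intro exI[of _ ?r]) auto
  qed
  then show ?thesis
    by metis
qed

lemma in_span_gram_schmidt_seq: "u n \<in> span (gram_schmidt_seq u ` {..n})"
proof -
  obtain c y where c: "0 < c" "gram_schmidt_seq u n = scale c (u n - y)"
    and y: "y = (\<Sum>k<n. scale (ip (u n) (gram_schmidt_seq u k)) (gram_schmidt_seq u k))"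
    by (rule gram_schmidt_seq_step)
  have "c \<noteq> 0" using c(1) by auto
  then have "u n = scale (1 / c) (gram_schmidt_seq u n) + y"
    by (simp add: c(2))
  also have "\<dots> \<in> span (gram_schmidt_seq u ` {..n})"
    unfolding y by (intro span_add span_scale span_sum) (auto intro: span_base)
  finally show ?thesis .
qed

(* Together with the orthonormality and coefficient theorems above: the recursively defined sequence is the only
   orthonormal system whose n-th member is a combination of u 0, ..., u n with positive
   coefficient at u n. *)
theorem gram_schmidt_seq_unique:
  assumes p: "orthonormal_seq p"
    and a: "\<And>n. p n = (\<Sum>j\<le>n. scale (a n j) (u j))" "\<And>n. 0 < a n n"
  shows "p = gram_schmidt_seq u"
proof
  fix n
  show "p n = gram_schmidt_seq u n"
  proof (induction n rule: less_induct)
    case (less n)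
    let ?g = "gram_schmidt_seq u"
    obtain c y where c: "0 < c" "y \<in> span (u ` {..<n})" "?g n = scale c (u n - y)"
      by (rule gram_schmidt_seq_step)
    have "c \<noteq> 0" using c(1) by auto
    define t where "t = a n n / c"
    have t: "0 < Re t" "Im t = 0"
      using c(1) a(2)[of n]
      by (auto simp: t_def less_complex_def Re_divide Im_divide power2_eq_square)
    define d where "d = p n - scale t (?g n)"
    have "d = (\<Sum>j<n. scale (a n j) (u j)) + scale (a n n) y"
      using \<open>c \<noteq> 0\<close>
      by (simp add: d_def t_def a(1)[of n] c(3) lessThan_Suc_atMost[symmetric]
          scale_right_diff_distrib)
    also have "\<dots> \<in> span (u ` {..<n})"
      by (intro span_add span_sum span_scale c(2)) (auto intro: span_base)
    finally have d: "d \<in> span (u ` {..<n})" .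
    have "u k \<in> span (?g ` {..<n})" if "k < n" for k
      using in_span_gram_schmidt_seq[of k] that
      by (meson atMost_iff image_mono le_less_trans lessThan_iff span_mono subsetD subsetI)
    then have "span (u ` {..<n}) \<subseteq> span (?g ` {..<n})"
      by (intro span_minimal) auto
    with d have d': "d \<in> span (?g ` {..<n})" by blast
    have "ip d z = 0" if "z \<in> ?g ` {..<n}" for z
    proof -
      from that obtain k where k: "k < n" "z = ?g k" by auto
      then have "ip (p n) z = 0"
        using p less[OF k(1)] unfolding orthonormal_seq_def by (metis less_irrefl)
      then show ?thesis
        using k gram_schmidt_seq_orthogonal[OF k(1)] by (simp add: d_def ip_diff_left ip_scale_left)
    qed
    then have "ip d d = 0"
      using d' by (rule ip_orthogonal_span)
    then have pn: "p n = scale t (?g n)"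
      using ip_eq_zeroD[of d] by (simp add: d_def)
    have "1 = t * cnj t"
      using p gram_schmidt_seq_orthonormal
      unfolding orthonormal_seq_def by (metis pn ip_scale_left ip_scale_right mult.right_neutral)
    then have "Re t * Re t = 1"
      using t(2) by (auto simp: complex_eq_iff)
    then have "t = 1"
      using t by (auto simp: complex_eq_iff square_eq_1_iff)
    then show ?case by (simp add: pn)
  qed
qed

(* The expansion of the orthonormal system in any sequence related to u by a triangular
   matrix with nonzero diagonal. *)
theorem gram_schmidt_seq_coefficients_triangular:
  assumes v: "\<And>n. v n = (\<Sum>j\<le>n. scale (c n j) (u j))" and c: "\<And>n. c n n \<noteq> 0"
  shows "\<exists>b. (\<forall>n. gram_schmidt_seq u n = (\<Sum>k\<le>n. scale (b n k) (v k)))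
     \<and> (\<forall>j k. j < k \<longrightarrow> b j k = 0)"
proof -
  have uv: "u n \<in> span (v ` {..n})" for n
  proof (induction n rule: less_induct)
    case (less n)
    have *: "u k \<in> span (v ` {..n})" if "k < n" for k
      using less[OF that] that by (meson atMost_subset_iff image_mono less_imp_le span_mono subsetD)
    have "v n = (\<Sum>j<n. scale (c n j) (u j)) + scale (c n n) (u n)"
      by (simp add: v[of n] lessThan_Suc_atMost[symmetric])
    then have "u n = scale (1 / c n n) (v n - (\<Sum>j<n. scale (c n j) (u j)))"
      using c[of n] by simp
    also have "\<dots> \<in> span (v ` {..n})"
      by (intro span_scale span_diff span_sum *) (auto intro: span_base)
    finally show ?case .
  qed
  have "\<exists>r. gram_schmidt_seq u n = (\<Sum>k\<le>n. scale (r k) (v k)) \<and> (\<forall>k>n. r k = 0)" for n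
  proof -
    have "u k \<in> span (v ` {..n})" if "k \<le> n" for k
      using uv[of k] that by (meson atMost_subset_iff image_mono span_mono subsetD)
    then have "span (u ` {..n}) \<subseteq> span (v ` {..n})"
      by (intro span_minimal) auto
    then have "gram_schmidt_seq u n \<in> span (v ` {..<Suc n})"
      using gram_schmidt_seq_in_span[of u n] by (auto simp: lessThan_Suc_atMost)
    then obtain r where "gram_schmidt_seq u n = (\<Sum>k<Suc n. scale (r k) (v k))"
      using span_image_lessThan by blast
    then show ?thesis
      by (intro exI[of _ "\<lambda>k. if k \<le> n then r k else 0"]) (auto simp: lessThan_Suc_atMost)
  qed
  then show ?thesis
    by metis
qed

end

end

(* The leading block of an infinite matrix, with indices 0, ..., n. *)
definition truncated_mat :: "nat \<Rightarrow> (nat \<Rightarrow> nat \<Rightarrow> complex) \<Rightarrow> complex mat" where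
  "truncated_mat n m = mat (n + 1) (n + 1) (\<lambda>(j, k). m j k)"

end

theory Submission
  imports Defs
begin

text \<open>
  A triangular change of vectors acts on the matrix of inner products by multiplication with the
  triangular matrix, on the left for the first family and with its adjoint on the right for the
  second. Applied to the inner products of \<open>p\<close> with itself, which form the identity matrix,
  this gives \<open>A * G * A\<^sup>* = 1\<close> and \<open>A * H * B\<^sup>* = 1\<close>; the first yields the
  determinants, the second the inverse of \<open>H\<close>.
\<close>

lemma truncated_mat_carrier [simp]: "truncated_mat n m \<in> carrier_mat (Suc n) (Suc n)"
  by (simp add: truncated_mat_def)

text \<open>Keeps adjoints in the form \<open>truncated_mat\<close>, so that products with them can
  be computed entrywise.\<close>

lemma mat_adjoint_truncated_mat:
  "mat_adjoint (truncated_mat n m) = truncated_mat n (\<lambda>j k. cnj (m k j))"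
  by (rule eq_matI) (auto simp: truncated_mat_def mat_adjoint_def mat_of_rows_def)

text \<open>The inner sum stops at \<open>n\<close>, the size of the blocks. Expansions that stop at
  their own row index are matched to it later by triangularity.\<close>

lemma truncated_mat_mult:
  "truncated_mat n m * truncated_mat n m' = truncated_mat n (\<lambda>j k. \<Sum>i\<le>n. m j i * m' i k)"
  by (rule eq_matI)
    (auto simp: truncated_mat_def scalar_prod_def atLeast0LessThan lessThan_Suc_atMost
      intro!: sum.cong)

lemma truncated_mat_cong:
  assumes "\<And>j k. j \<le> n \<Longrightarrow> k \<le> n \<Longrightarrow> m j k = m' j k"
  shows "truncated_mat n m = truncated_mat n m'"
  by (rule eq_matI) (auto simp: truncated_mat_def assms)

lemma det_truncated_mat_triangular:
  assumes "\<And>j k. j < k \<Longrightarrow> m j k = 0"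
  shows "det (truncated_mat n m) = (\<Prod>j\<le>n. m j j)"
proof -
  have "det (truncated_mat n m) = prod_list (diag_mat (truncated_mat n m))"
    by (rule det_lower_triangular[OF _ truncated_mat_carrier]) (auto simp: truncated_mat_def assms)
  also have "\<dots> = (\<Prod>j\<le>n. m j j)"
    by (auto simp: prod_list_diag_prod truncated_mat_def atLeast0LessThan lessThan_Suc_atMost
      intro!: prod.cong)
  finally show ?thesis .
qed

text \<open>The adjoint is the transpose of the entrywise conjugate, which is still lower
  triangular, and transposing preserves the determinant.\<close>

lemma det_mat_adjoint_truncated_mat_triangular:
  assumes "\<And>j k. j < k \<Longrightarrow> m j k = 0"
  shows "det (mat_adjoint (truncated_mat n m)) = (\<Prod>j\<le>n. cnj (m j j))"
proof -
  have "mat_adjoint (truncated_mat n m) = transpose_mat (truncated_mat n (\<lambda>j k. cnj (m j k)))"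
    unfolding mat_adjoint_truncated_mat by (rule eq_matI) (auto simp: truncated_mat_def)
  then show ?thesis
    using assms by (simp add: det_transpose[OF truncated_mat_carrier] det_truncated_mat_triangular)
qed

context complex_inner_product_space
begin

text \<open>Linearity in the first argument turns the expansion of \<open>x j\<close> into row
  \<open>j\<close> of a matrix product. Only \<open>u 0\<close>, ..., \<open>u j\<close> occur with
  \<open>j \<le> n\<close>, so the finite block loses nothing.\<close>

lemma truncated_mat_ip_left:
  assumes x: "\<And>i. x i = (\<Sum>j\<le>i. scale (m i j) (u j))"
    and m: "\<And>j k. j < k \<Longrightarrow> m j k = 0"
  shows "truncated_mat n (\<lambda>j k. ip (x j) (y k))
    = truncated_mat n m * truncated_mat n (\<lambda>j k. ip (u j) (y k))"
  unfolding truncated_mat_mult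
proof (rule truncated_mat_cong)
  fix j k assume "j \<le> n"
  have "ip (x j) (y k) = (\<Sum>i\<le>j. m j i * ip (u i) (y k))"
    by (simp add: x ip_sum_left ip_scale_left)
  \<comment> \<open>The entries \<open>m j i\<close> with \<open>j < i\<close> vanish, so every row
    can be padded to the common length.\<close>
  also have "\<dots> = (\<Sum>i\<le>n. m j i * ip (u i) (y k))"
    using \<open>j \<le> n\<close> by (intro sum.mono_neutral_left) (auto simp: m)
  finally show "ip (x j) (y k) = (\<Sum>i\<le>n. m j i * ip (u i) (y k))" .
qed

text \<open>In the second argument the coefficients come out conjugated and are indexed by the
  column, hence the adjoint on the right.\<close>

lemma truncated_mat_ip_right:
  assumes y: "\<And>i. y i = (\<Sum>j\<le>i. scale (m i j) (v j))"
    and m: "\<And>j k. j < k \<Longrightarrow> m j k = 0"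
  shows "truncated_mat n (\<lambda>j k. ip (x j) (y k))
    = truncated_mat n (\<lambda>j k. ip (x j) (v k)) * mat_adjoint (truncated_mat n m)"
  unfolding mat_adjoint_truncated_mat truncated_mat_mult
proof (rule truncated_mat_cong)
  fix j k assume "k \<le> n"
  \<comment> \<open>Conjugate symmetry moves the expansion into the first argument, where the form
    is linear.\<close>
  have "ip (x j) (y k) = cnj (\<Sum>i\<le>k. m k i * ip (v i) (x j))"
    by (subst ip_commute) (simp add: y ip_sum_left ip_scale_left)
  also have "\<dots> = (\<Sum>i\<le>k. ip (x j) (v i) * cnj (m k i))"
    by (simp add: ip_commute[of _ "x j"] mult.commute)
  also have "\<dots> = (\<Sum>i\<le>n. ip (x j) (v i) * cnj (m k i))"
    using \<open>k \<le> n\<close> by (intro sum.mono_neutral_left) (auto simp: m)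
  finally show "ip (x j) (y k) = (\<Sum>i\<le>n. ip (x j) (v i) * cnj (m k i))" .
qed

lemma truncated_mat_ip_orthonormal:
  assumes "orthonormal_seq p"
  shows "truncated_mat n (\<lambda>j k. ip (p j) (p k)) = 1\<^sub>m (n + 1)"
  using assms by (intro eq_matI) (auto simp: truncated_mat_def orthonormal_seq_def)

end

theorem theorem1:
  fixes scale :: "complex \<Rightarrow> 'e::ab_group_add \<Rightarrow> 'e"
    and ip :: "'e \<Rightarrow> 'e \<Rightarrow> complex"
    and u v p :: "nat \<Rightarrow> 'e"
    and a b c :: "nat \<Rightarrow> nat \<Rightarrow> complex"
    and n :: nat
  assumes "complex_inner_product_space scale ip"
    and "inj u" and "\<not> module.dependent scale (range u)"
    and "p = complex_inner_product_space.gram_schmidt_seq scale ip u"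
    and "\<And>i. p i = (\<Sum>j\<le>i. scale (a i j) (u j))"
    and "\<And>i. 0 < a i i"
    and "\<And>i. v i = (\<Sum>j\<le>i. scale (c i j) (u j))"
    and "\<And>i. c i i \<noteq> 0"
    and "\<And>i. p i = (\<Sum>k\<le>i. scale (b i k) (v k))"
    and "\<And>j k. j < k \<Longrightarrow> a j k = 0"
    and "\<And>j k. j < k \<Longrightarrow> b j k = 0"
    and "\<And>j k. j < k \<Longrightarrow> c j k = 0"
  shows
    "let G = truncated_mat n (\<lambda>j k. ip (u j) (u k));
         H = truncated_mat n (\<lambda>j k. ip (u j) (v k));
         A = truncated_mat n a;
         B = truncated_mat n b;
         C = truncated_mat n c
     in H = G * mat_adjoint C
      \<and> inverts_mat H (mat_adjoint B * A) \<and> inverts_mat (mat_adjoint B * A) H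
      \<and> det G = (\<Prod>j\<le>n. a j j powi (-2))
      \<and> det C = (\<Prod>j\<le>n. c j j)
      \<and> det H = (\<Prod>j\<le>n. cnj (c j j) / (a j j)\<^sup>2)"
proof -
  interpret complex_inner_product_space scale ip by fact
  define G where "G = truncated_mat n (\<lambda>j k. ip (u j) (u k))"
  define H where "H = truncated_mat n (\<lambda>j k. ip (u j) (v k))"
  define A where "A = truncated_mat n a"
  define B where "B = truncated_mat n b"
  define C where "C = truncated_mat n c"
  have carrier: "G \<in> carrier_mat (n + 1) (n + 1)" "H \<in> carrier_mat (n + 1) (n + 1)"
    "A \<in> carrier_mat (n + 1) (n + 1)" "mat_adjoint A \<in> carrier_mat (n + 1) (n + 1)"
    "mat_adjoint B \<in> carrier_mat (n + 1) (n + 1)" "mat_adjoint C \<in> carrier_mat (n + 1) (n + 1)"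
    by (simp_all add: G_def H_def A_def B_def C_def mat_adjoint_truncated_mat)
  have p: "truncated_mat n (\<lambda>j k. ip (p j) (p k)) = 1\<^sub>m (n + 1)"
    unfolding assms(4)
    by (rule truncated_mat_ip_orthonormal[OF gram_schmidt_seq_orthonormal[OF assms(2,3)]])
  have H: "H = G * mat_adjoint C"
    unfolding G_def H_def C_def by (rule truncated_mat_ip_right[OF assms(7,12)])
  \<comment> \<open>Only the first argument is expanded here. The remaining mixed matrix of
    \<open>u\<close> against \<open>p\<close> is then factored in two ways, by expanding
    \<open>p\<close> in \<open>u\<close> and in \<open>v\<close>.\<close>
  have pu: "A * truncated_mat n (\<lambda>j k. ip (u j) (p k)) = 1\<^sub>m (n + 1)"
    unfolding A_def p[symmetric] by (rule truncated_mat_ip_left[OF assms(5,10), symmetric])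
  have "truncated_mat n (\<lambda>j k. ip (u j) (p k)) = G * mat_adjoint A"
    unfolding G_def A_def by (rule truncated_mat_ip_right[OF assms(5,10)])
  with pu have AGA: "A * (G * mat_adjoint A) = 1\<^sub>m (n + 1)"
    by simp
  have "truncated_mat n (\<lambda>j k. ip (u j) (p k)) = H * mat_adjoint B"
    unfolding H_def B_def by (rule truncated_mat_ip_right[OF assms(9,11)])
  with pu have AHB: "A * (H * mat_adjoint B) = 1\<^sub>m (n + 1)"
    by simp
  \<comment> \<open>For square matrices a right inverse is also a left inverse. Used on
    \<open>A\<close>, this moves \<open>A\<close> to the right end; used again on \<open>H\<close>,
    it gives the other side of the inverse.\<close>
  have "H * mat_adjoint B * A = 1\<^sub>m (n + 1)"
    using mat_mult_left_right_inverse[OF _ _ AHB] carrier by simp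
  then have HBA: "H * (mat_adjoint B * A) = 1\<^sub>m (n + 1)"
    using carrier by (simp add: assoc_mult_mat)
  then have BAH: "mat_adjoint B * A * H = 1\<^sub>m (n + 1)"
    using mat_mult_left_right_inverse[OF _ _ HBA] carrier by simp
  \<comment> \<open>Positivity in the order on complex numbers includes being real, so
    \<open>A\<close> and its adjoint have the same diagonal and the same determinant.\<close>
  have cnj_a: "cnj (a j j) = a j j" for j
    using assms(6)[of j] by (simp add: complex_eq_iff less_complex_def)
  have a_nonzero: "a j j \<noteq> 0" for j
    using assms(6)[of j] by auto
  have "(\<Prod>j\<le>n. a j j) * (det G * (\<Prod>j\<le>n. a j j)) = det A * (det G * det (mat_adjoint A))"
    by (simp add: A_def det_truncated_mat_triangular assms(10)
        det_mat_adjoint_truncated_mat_triangular cnj_a)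
  also have "\<dots> = det (A * (G * mat_adjoint A))"
    by (simp add: det_mult[OF carrier(3) mult_carrier_mat[OF carrier(1,4)]]
        det_mult[OF carrier(1,4)])
  also have "\<dots> = 1"
    by (simp add: AGA)
  finally have "det G = 1 / (\<Prod>j\<le>n. a j j)\<^sup>2"
    using a_nonzero by (simp add: field_simps power2_eq_square)
  \<comment> \<open>Written as one product over \<open>j\<close>, this merges factor by factor with
    the determinant of \<open>mat_adjoint C\<close> to give \<open>det H\<close>.\<close>
  then have detG: "det G = (\<Prod>j\<le>n. 1 / (a j j)\<^sup>2)"
    by (simp add: prod_dividef prod_power_distrib)
  have detH: "det H = (\<Prod>j\<le>n. cnj (c j j) / (a j j)\<^sup>2)"
    unfolding H det_mult[OF carrier(1,6)] detG
    by (simp add: C_def det_mat_adjoint_truncated_mat_triangular assms(12)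
        flip: prod.distrib)
  have inverse: "inverts_mat H (mat_adjoint B * A)" "inverts_mat (mat_adjoint B * A) H"
    using HBA BAH carrier(2,5) by (simp_all add: inverts_mat_def)
  have detC: "det C = (\<Prod>j\<le>n. c j j)"
    unfolding C_def by (rule det_truncated_mat_triangular[OF assms(12)])
  have "det G = (\<Prod>j\<le>n. a j j powi (-2))"
    by (simp add: detG power_int_minus divide_inverse)
  with H inverse detC detH show ?thesis
    unfolding Let_def G_def H_def A_def B_def C_def by blast
qed

end
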